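(* Let $A \in M_n(\mathbb{C})$ with $\mathrm{rank}(A)=r>0$ be written in a Hartwig-Spindelböck decomposition $$A = U \begin{pmatrix} \Sigma Q & \Sigma P \\ 0 & 0\end{pmatrix} U^{*}.$$ If $(\Sigma Q)^{\mathrm{cep}} = (\Sigma Q)^{d}$, then the CMP-inverse $A^{c,\dagger}$ is an EP matrix if and only if $$A^{C,\mathrm{cep}}(A^{c,\dagger})^{\dagger} = (A^{c,\dagger})^{\dagger}A^{C,\mathrm{cep}}.$$
   Context: $M^{\dagger}$ is the Moore-Penrose inverse and $M^{d}$ the Drazin inverse of a (square) matrix $M$. A square matrix $M$ is EP if $MM^{\dagger}=M^{\dagger}M$. For a square matrix $M$ with index $k=\mathrm{Ind}(M)$ (the smallest non-negative integer with $\mathrm{rank}(M^{k})=\mathrm{rank}(M^{k+1})$), $M^{\mathrm{cep}}$ denotes the core-EP inverse of $M$: the unique $X$ with $XMX=X$ and $\mathcal{R}(X)=\mathcal{R}(X^{*})=\mathcal{R}(M^{k})$, where $\mathcal{R}$ is the column space. The CCE-inverse of $A$ is $A^{C,\mathrm{cep}} = A^{\dagger}A\,A^{\mathrm{cep}}\,AA^{\dagger}$. The core part of $A$ is $A_c=AA^{d}A$ and the CMP-inverse of $A$ is $A^{c,\dagger}=A^{\dagger}A_cA^{\dagger}$. In a Hartwig-Spindelböck decomposition of a matrix $A\in M_n(\mathbb{C})$ of rank $r>0$, $U\in M_n(\mathbb{C})$ is unitary, $\Sigma = \mathrm{diag}(\sigma_1 I_{k_1},\dots,\sigma_t I_{k_t})\in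 M_r(\mathbb{C})$ is diagonal with the nonzero singular values $\sigma_j>0$ of $A$ on the diagonal ($k_1+\dots+k_t=r$), and $Q\in M_r(\mathbb{C})$, $P\in M_{r,n-r}(\mathbb{C})$ satisfy $QQ^{*}+PP^{*}=I_r$. Every nonzero matrix has such a decomposition. *)

theory Defs
  imports
    "Jordan_Normal_Form.DL_Rank"
    "Jordan_Normal_Form.Schur_Decomposition"
    "Jordan_Normal_Form.Char_Poly"
begin

definition mat_rank :: "complex mat \<Rightarrow> nat" where
  "mat_rank M = vec_space.rank (dim_row M) M"

definition column_space :: "complex mat \<Rightarrow> complex vec set" where
  "column_space M = {M *\<^sub>v v | v. v \<in> carrier_vec (dim_col M)}"

definition unitary_mat :: "complex mat \<Rightarrow> bool" where
  "unitary_mat U \<longleftrightarrow>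
     square_mat U \<and>
     mat_adjoint U * U = 1\<^sub>m (dim_row U) \<and> U * mat_adjoint U = 1\<^sub>m (dim_row U)"

definition mat_index :: "complex mat \<Rightarrow> nat" where
  "mat_index M = (LEAST k. mat_rank (M ^\<^sub>m k) = mat_rank (M ^\<^sub>m (k + 1)))"

definition is_moore_penrose :: "complex mat \<Rightarrow> complex mat \<Rightarrow> bool" where
  "is_moore_penrose M X \<longleftrightarrow>
     X \<in> carrier_mat (dim_col M) (dim_row M) \<and>
     M * X * M = M \<and> X * M * X = X \<and>
     mat_adjoint (M * X) = M * X \<and> mat_adjoint (X * M) = X * M"

definition moore_penrose :: "complex mat \<Rightarrow> complex mat" where
  "moore_penrose M = (THE X. is_moore_penrose M X)"

text \<open>The inverses below are meaningful for square matrices only.\<close>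

definition is_drazin :: "complex mat \<Rightarrow> complex mat \<Rightarrow> bool" where
  "is_drazin M X \<longleftrightarrow>
     X \<in> carrier_mat (dim_row M) (dim_row M) \<and>
     X * M * X = X \<and> M * X = X * M \<and>
     M ^\<^sub>m (mat_index M + 1) * X = M ^\<^sub>m (mat_index M)"

definition drazin :: "complex mat \<Rightarrow> complex mat" where
  "drazin M = (THE X. is_drazin M X)"

definition is_core_EP_inverse :: "complex mat \<Rightarrow> complex mat \<Rightarrow> bool" where
  "is_core_EP_inverse M X \<longleftrightarrow>
     X \<in> carrier_mat (dim_row M) (dim_row M) \<and>
     X * M * X = X \<and>
     column_space X = column_space (M ^\<^sub>m (mat_index M)) \<and>
     column_space (mat_adjoint X) = column_space (M ^\<^sub>m (mat_index M))"

definition core_EP_inverse :: "complex mat \<Rightarrow> complex mat" where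
  "core_EP_inverse M = (THE X. is_core_EP_inverse M X)"

definition EP_mat :: "complex mat \<Rightarrow> bool" where
  "EP_mat M \<longleftrightarrow> square_mat M \<and> M * moore_penrose M = moore_penrose M * M"

definition CCE_inverse :: "complex mat \<Rightarrow> complex mat" where
  "CCE_inverse A = moore_penrose A * A * core_EP_inverse A * A * moore_penrose A"

definition core_part :: "complex mat \<Rightarrow> complex mat" where
  "core_part A = A * drazin A * A"

definition CMP_inverse :: "complex mat \<Rightarrow> complex mat" where
  "CMP_inverse A = moore_penrose A * core_part A * moore_penrose A"

text \<open>Singular values, with multiplicity, as the square roots of the (real, nonnegative)
  eigenvalues of \<open>A\<^sup>* A\<close>.\<close>

definition singular_values :: "complex mat \<Rightarrow> real multiset" where
  "singular_values A = image_mset (\<lambda>z. sqrt (Re z)) (proots (char_poly (mat_adjoint A * A)))"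

definition is_singular_value_diag :: "complex mat \<Rightarrow> complex mat \<Rightarrow> bool" where
  "is_singular_value_diag A S \<longleftrightarrow>
     (\<exists>\<sigma> k. length \<sigma> = length k \<and>
        (\<forall>s \<in> set \<sigma>. s > 0) \<and> (\<forall>m \<in> set k. m > 0) \<and>
        mset (concat (map2 (\<lambda>s m. replicate m s) \<sigma> k)) = {#s \<in># singular_values A. s \<noteq> 0#} \<and>
        S = diag_block_mat (map2 (\<lambda>s m. complex_of_real s \<cdot>\<^sub>m 1\<^sub>m m) \<sigma> k))"

definition hartwig_spindelboeck ::
  "nat \<Rightarrow> nat \<Rightarrow> complex mat \<Rightarrow> complex mat \<Rightarrow> complex mat \<Rightarrow> complex mat \<Rightarrow> complex mat \<Rightarrow> bool" where
  "hartwig_spindelboeck n r A U S Q P \<longleftrightarrow>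
     U \<in> carrier_mat n n \<and> unitary_mat U \<and>
     S \<in> carrier_mat r r \<and> is_singular_value_diag A S \<and>
     Q \<in> carrier_mat r r \<and> P \<in> carrier_mat r (n - r) \<and>
     Q * mat_adjoint Q + P * mat_adjoint P = 1\<^sub>m r \<and>
     A = U * four_block_mat (S * Q) (S * P) (0\<^sub>m (n - r) r) (0\<^sub>m (n - r) (n - r)) * mat_adjoint U"

end

theory Submission
  imports Defs
begin

text \<open>Write \<open>A = V B\<close> with \<open>V = U (I, 0)\<^sup>T\<close> and \<open>B = \<Sigma> (Q, P) U\<^sup>*\<close>, so that \<open>V\<^sup>* V = I\<close>,
  \<open>B\<close> is right invertible and \<open>B V = \<Sigma> Q\<close>. Then \<open>A A\<^sup>\<dagger> = V V\<^sup>*\<close>, Cline's formula gives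
  \<open>A\<^sup>d = V ((B V)\<^sup>d)\<^sup>2 B\<close>, and the core-EP inverse of \<open>A\<close> is \<open>V X V\<^sup>*\<close> with \<open>X\<close> the core-EP inverse
  of \<open>B V\<close>. Hence the CCE- and CMP-inverses of \<open>A\<close> are \<open>A\<^sup>\<dagger> A V X V\<^sup>*\<close> and \<open>A\<^sup>\<dagger> A V (B V)\<^sup>d V\<^sup>*\<close>.
  The hypothesis makes them equal, and commuting with the Moore-Penrose inverse of the
  CMP-inverse is then the very definition of EP.\<close>

section \<open>Adjoints and column spaces\<close>

lemma mult_mat_assoc:
  fixes A B C :: "'a::semiring_0 mat"
  assumes "dim_col A = dim_row B" "dim_col B = dim_row C"
  shows "A * B * C = A * (B * C)"
  by (rule assoc_mult_mat[of _ "dim_row A" "dim_row B" _ "dim_row C" _ "dim_col C"])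
    (use assms in auto)

lemma dim_mat_adjoint [simp]:
  "dim_row (mat_adjoint A) = dim_col A" "dim_col (mat_adjoint A) = dim_row A"
  by (auto simp: mat_adjoint_def)

lemma index_mat_adjoint [simp]:
  assumes "i < dim_col A" "j < dim_row A"
  shows "mat_adjoint A $$ (i, j) = conjugate (A $$ (j, i))"
  using assms by (auto simp: mat_adjoint_def mat_of_rows_index)

lemma mat_adjoint_carrier [simp]:
  "A \<in> carrier_mat n m \<Longrightarrow> mat_adjoint A \<in> carrier_mat m n"
  by auto

lemma mat_adjoint_mat_adjoint [simp]: "mat_adjoint (mat_adjoint A) = A"
  by (rule eq_matI) auto

lemma mat_adjoint_mult:
  assumes "dim_col A = dim_row B"
  shows "mat_adjoint (A * B) = mat_adjoint B * mat_adjoint A"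
proof (rule eq_matI)
  fix i j assume ij: "i < dim_row (mat_adjoint B * mat_adjoint A)" "j < dim_col (mat_adjoint B * mat_adjoint A)"
  then have "mat_adjoint (A * B) $$ (i, j) = conjugate (\<Sum>k<dim_row B. A $$ (j, k) * B $$ (k, i))"
    using assms by (simp add: scalar_prod_def atLeast0LessThan)
  also have "\<dots> = (\<Sum>k<dim_row B. mat_adjoint B $$ (i, k) * mat_adjoint A $$ (k, j))"
    using assms ij by (simp add: sum_conjugate conjugate_dist_mul mult.commute)
  also have "\<dots> = (mat_adjoint B * mat_adjoint A) $$ (i, j)"
    using assms ij by (simp add: scalar_prod_def atLeast0LessThan)
  finally show "mat_adjoint (A * B) $$ (i, j) = (mat_adjoint B * mat_adjoint A) $$ (i, j)" .
qed auto

lemma mat_adjoint_one [simp]: "mat_adjoint (1\<^sub>m n :: complex mat) = 1\<^sub>m n"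
  by (rule eq_matI) auto

text \<open>The diagonal entries of \<open>mat_adjoint A * A\<close> are the squared Euclidean norms
  of the columns of \<open>A\<close>.\<close>

lemma mat_adjoint_mult_self_eq_0:
  fixes A :: "complex mat"
  assumes "A \<in> carrier_mat n m" "mat_adjoint A * A = 0\<^sub>m m m"
  shows "A = 0\<^sub>m n m"
proof (rule eq_matI)
  fix i j assume ij: "i < dim_row (0\<^sub>m n m :: complex mat)" "j < dim_col (0\<^sub>m n m :: complex mat)"
  have "(\<Sum>k<n. (cmod (A $$ (k, j)))\<^sup>2) = Re ((mat_adjoint A * A) $$ (j, j))"
    using assms(1) ij
    by (simp add: scalar_prod_def atLeast0LessThan cmod_power2) (simp add: power2_eq_square)
  also have "\<dots> = 0" using assms(2) ij by simp
  finally have "A $$ (i, j) = 0"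
    using ij by (subst (asm) sum_nonneg_eq_0_iff) auto
  then show "A $$ (i, j) = 0\<^sub>m n m $$ (i, j)" using ij by simp
qed (use assms in auto)

text \<open>Turns range inclusions into factorizations, so that later arguments about ranges become
  matrix algebra. \<open>Z\<close> is assembled column by column from preimages of the columns of
  \<open>A\<close>.\<close>

lemma column_space_subset_iff:
  assumes "A \<in> carrier_mat n m" "B \<in> carrier_mat n l"
  shows "column_space A \<subseteq> column_space B \<longleftrightarrow> (\<exists>Z \<in> carrier_mat l m. A = B * Z)"
proof
  assume sub: "column_space A \<subseteq> column_space B"
  have "\<exists>z \<in> carrier_vec l. B *\<^sub>v z = col A j" if "j < m" for j
  proof -
    have "A *\<^sub>v unit_vec m j \<in> column_space A"
      using assms(1) by (auto simp: column_space_def)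
    moreover have "A *\<^sub>v unit_vec m j = col A j"
      using assms(1) that by (intro eq_vecI) auto
    ultimately show ?thesis
      using sub assms(2) unfolding column_space_def by (smt (verit) carrier_matD(2) mem_Collect_eq subsetD)
  qed
  then obtain z where z: "\<And>j. j < m \<Longrightarrow> z j \<in> carrier_vec l \<and> B *\<^sub>v z j = col A j"
    by metis
  define Z where "Z = mat_of_cols l (map z [0..<m])"
  have Z: "Z \<in> carrier_mat l m" by (auto simp: Z_def)
  have "A = B * Z"
  proof (rule mat_col_eqI)
    fix j assume "j < dim_col (B * Z)"
    with Z have j: "j < m" by simp
    with Z have "col (B * Z) j = B *\<^sub>v col Z j"
      using assms(2) by (metis carrier_matD(2) col_mult2)
    also have "col Z j = z j" using j z by (auto simp: Z_def)
    finally show "col A j = col (B * Z) j" using z j by simp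
  qed (use assms Z in auto)
  with Z show "\<exists>Z \<in> carrier_mat l m. A = B * Z" by blast
next
  assume "\<exists>Z \<in> carrier_mat l m. A = B * Z"
  then obtain Z where Z: "Z \<in> carrier_mat l m" "A = B * Z" by blast
  show "column_space A \<subseteq> column_space B"
  proof
    fix y assume "y \<in> column_space A"
    then obtain v where "v \<in> carrier_vec m" "y = A *\<^sub>v v"
      using assms by (auto simp: column_space_def)
    with Z assms(2) have "y = B *\<^sub>v (Z *\<^sub>v v)" "Z *\<^sub>v v \<in> carrier_vec (dim_col B)" by auto
    then show "y \<in> column_space B" unfolding column_space_def by blast
  qed
qed

lemma column_space_mult_subset:
  assumes "A \<in> carrier_mat n l" "B \<in> carrier_mat l m"
  shows "column_space (A * B) \<subseteq> column_space A"
  using assms by (intro column_space_subset_iff[THEN iffD2, of _ n m _ l]) auto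

lemma column_space_eqI:
  assumes "A \<in> carrier_mat n m" "B \<in> carrier_mat n l"
    and "Y \<in> carrier_mat l m" "A = B * Y" "Z \<in> carrier_mat m l" "B = A * Z"
  shows "column_space A = column_space B"
proof
  show "column_space A \<subseteq> column_space B"
    using column_space_mult_subset[OF assms(2,3)] assms(4) by simp
  show "column_space B \<subseteq> column_space A"
    using column_space_mult_subset[OF assms(1,5)] assms(6) by simp
qed

section \<open>Rank as the dimension of the column space\<close>

lemma (in vectorspace) subspace_eqI:
  assumes W1: "VectorSpace.subspace K W1 V" and W2: "VectorSpace.subspace K W2 V" and sub: "W1 \<subseteq> W2"
    and fin: "vectorspace.fin_dim K (vs W1)" "vectorspace.fin_dim K (vs W2)"
    and dim: "vectorspace.dim K (vs W1) = vectorspace.dim K (vs W2)"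
  shows "W1 = W2"
proof -
  interpret w1: vectorspace K "vs W1" by (rule subspace_is_vs[OF W1])
  interpret w2: vectorspace K "vs W2" by (rule subspace_is_vs[OF W2])
  obtain b where b: "finite b" "w1.basis b" using w1.finite_basis_exists fin(1) by blast
  then have bW: "b \<subseteq> W1" "w1.lin_indpt b" "w1.span b = W1" "card b = w1.dim"
    using w1.dim_basis by (auto simp: w1.basis_def)
  have sm: "submodule K W1 V" "submodule K W2 V"
    using W1 W2 by (auto simp: VectorSpace.subspace_def)
  \<comment> \<open>Independence and span do not depend on the ambient subspace, so the basis
    \<open>b\<close> of \<open>W1\<close> stays independent in \<open>W2\<close>. Since it has as
    many elements as the dimension of \<open>W2\<close>, it is a basis there too and spans
    both.\<close>
  have li: "w2.lin_indpt b" and sp: "w2.span b = W1"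
    using span_li_not_depend[OF bW(1) sm(1)] span_li_not_depend[of b, OF _ sm(2)] bW sub by auto
  have "w2.basis b"
    using w2.dim_li_is_basis[OF fin(2) b(1) _ li] bW sub dim by auto
  then show ?thesis using sp by (simp add: w2.basis_def)
qed

lemma mat_rank_eq_dim_column_space:
  assumes "A \<in> carrier_mat n m"
  shows "mat_rank A = vectorspace.dim class_ring (module_vec TYPE(complex) n\<lparr>carrier := column_space A\<rparr>)"
    and "VectorSpace.subspace class_ring (column_space A) (module_vec TYPE(complex) n)"
    and "vectorspace.fin_dim class_ring (module_vec TYPE(complex) n\<lparr>carrier := column_space A\<rparr>)"
proof -
  interpret v: vec_space "TYPE(complex)" n .
  have *: "column_space A = v.span (set (cols A))"
    using v.col_space_eq[OF assms] assms
    by (auto simp: v.col_space_def column_space_def)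
  have c: "set (cols A) \<subseteq> carrier_vec n" using cols_dim assms by blast
  show "mat_rank A = vectorspace.dim class_ring (module_vec TYPE(complex) n\<lparr>carrier := column_space A\<rparr>)"
    using assms by (simp add: mat_rank_def v.rank_def *)
  show "VectorSpace.subspace class_ring (column_space A) (module_vec TYPE(complex) n)"
    using v.span_is_subspace c * by simp
  show "vectorspace.fin_dim class_ring (module_vec TYPE(complex) n\<lparr>carrier := column_space A\<rparr>)"
    using v.fin_dim_span_cols[OF assms] * by simp
qed

lemma mat_rank_le_dim_row:
  assumes "A \<in> carrier_mat n m"
  shows "mat_rank A \<le> n"
proof -
  interpret v: vec_space "TYPE(complex)" n .
  show ?thesis
    using v.subspace_dim[of "column_space A"] mat_rank_eq_dim_column_space[OF assms] v.dim_is_n by simp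
qed

lemma mat_rank_mono:
  assumes "A \<in> carrier_mat n m" "B \<in> carrier_mat n l" "column_space A \<subseteq> column_space B"
  shows "mat_rank A \<le> mat_rank B"
proof -
  interpret v: vec_space "TYPE(complex)" n .
  note A = mat_rank_eq_dim_column_space[OF assms(1)] and B = mat_rank_eq_dim_column_space[OF assms(2)]
  interpret w: vectorspace class_ring "v.vs (column_space B)" by (rule v.subspace_is_vs[OF B(2)])
  show ?thesis
    using w.subspace_dim[OF v.nested_subspaces[OF B(2) A(2) assms(3)] B(3)] A(3)
    unfolding A(1) B(1) by simp
qed

lemma column_space_eq_if_mat_rank_eq:
  assumes "A \<in> carrier_mat n m" "B \<in> carrier_mat n l" "column_space A \<subseteq> column_space B"
    and "mat_rank A = mat_rank B"
  shows "column_space A = column_space B"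
proof -
  interpret v: vec_space "TYPE(complex)" n .
  note A = mat_rank_eq_dim_column_space[OF assms(1)] and B = mat_rank_eq_dim_column_space[OF assms(2)]
  show ?thesis
    using v.subspace_eqI[OF A(2) B(2) assms(3) A(3) B(3)] assms(4) unfolding A(1) B(1) by simp
qed

section \<open>Powers and the index\<close>

lemma pow_mat_add:
  assumes "A \<in> carrier_mat n n"
  shows "A ^\<^sub>m (i + j) = A ^\<^sub>m i * A ^\<^sub>m j"
proof (induction j)
  case 0
  then show ?case using assms by simp
next
  case (Suc j)
  then show ?case using assms by (simp add: mult_mat_assoc)
qed

lemma pow_mat_Suc_left:
  assumes "A \<in> carrier_mat n n"
  shows "A ^\<^sub>m Suc k = A * A ^\<^sub>m k"
  using pow_mat_add[OF assms, of 1 k] assms by simp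

lemma pow_mat_commute:
  assumes "A \<in> carrier_mat n n" "B \<in> carrier_mat n n" "A * B = B * A"
  shows "A ^\<^sub>m k * B = B * A ^\<^sub>m k"
proof (induction k)
  case 0
  then show ?case using assms by simp
next
  case (Suc k)
  have "A ^\<^sub>m Suc k * B = A ^\<^sub>m k * (A * B)" using assms by (simp add: mult_mat_assoc)
  also have "\<dots> = A ^\<^sub>m k * B * A" using assms by (simp add: mult_mat_assoc)
  also have "\<dots> = B * A ^\<^sub>m Suc k" using Suc assms by (simp add: mult_mat_assoc)
  finally show ?case .
qed

lemma pow_mat_transpose:
  assumes "(A :: 'a::comm_semiring_1 mat) \<in> carrier_mat n n"
  shows "(A\<^sup>T) ^\<^sub>m k = (A ^\<^sub>m k)\<^sup>T"
proof (induction k)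
  case 0
  then show ?case using assms by simp
next
  case (Suc k)
  have "(A ^\<^sub>m Suc k)\<^sup>T = (A * A ^\<^sub>m k)\<^sup>T" using pow_mat_Suc_left[OF assms] by simp
  also have "\<dots> = (A ^\<^sub>m k)\<^sup>T * A\<^sup>T" using assms by (intro transpose_mult) auto
  finally show ?case using Suc by simp
qed

text \<open>\<open>mat_index\<close> is a \<open>LEAST\<close>, so it has the defining property only
  if the ranks of the powers stabilise somewhere. They never increase, and a strict drop at every
  step would eventually take them below zero.\<close>

lemma mat_index_rank:
  assumes M: "M \<in> carrier_mat n n"
  shows "mat_rank (M ^\<^sub>m mat_index M) = mat_rank (M ^\<^sub>m (mat_index M + 1))"
proof -
  have mono: "mat_rank (M ^\<^sub>m (k + 1)) \<le> mat_rank (M ^\<^sub>m k)" for k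
    by (rule mat_rank_mono[of _ n n _ n])
      (use M column_space_mult_subset[of "M ^\<^sub>m k" n n M n] in auto)
  have "\<exists>k. mat_rank (M ^\<^sub>m k) = mat_rank (M ^\<^sub>m (k + 1))"
  proof (rule ccontr)
    assume "\<not> ?thesis"
    then have less: "mat_rank (M ^\<^sub>m (k + 1)) < mat_rank (M ^\<^sub>m k)" for k
      using mono[of k] by (metis le_neq_implies_less)
    have "mat_rank (M ^\<^sub>m k) + k \<le> mat_rank (M ^\<^sub>m 0)" for k
    proof (induction k)
      case (Suc k)
      then show ?case using less[of k] by (simp del: pow_mat.simps)
    qed simp
    from this[of "Suc (mat_rank (M ^\<^sub>m 0))"] show False by linarith
  qed
  then show ?thesis unfolding mat_index_def by (rule LeastI_ex)
qed

text \<open>Here the rank condition of the index becomes an equation: equal ranks upgrade the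
  inclusion of ranges to equality, and the reverse inclusion is a factorization.\<close>

lemma pow_mat_index_factor_Suc:
  assumes M: "M \<in> carrier_mat n n"
  obtains Y where "Y \<in> carrier_mat n n" "M ^\<^sub>m mat_index M = M ^\<^sub>m Suc (mat_index M) * Y"
proof -
  let ?k = "mat_index M"
  have c: "M ^\<^sub>m j \<in> carrier_mat n n" for j using M by simp
  have "column_space (M ^\<^sub>m Suc ?k) \<subseteq> column_space (M ^\<^sub>m ?k)"
    using M column_space_mult_subset[OF c M] by simp
  then have "column_space (M ^\<^sub>m ?k) \<subseteq> column_space (M ^\<^sub>m Suc ?k)"
    using column_space_eq_if_mat_rank_eq[OF c c, of "Suc ?k" ?k] mat_index_rank[OF M] by simp
  then show ?thesis using that column_space_subset_iff[THEN iffD1, OF c c] by blast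
qed

lemma pow_mat_index_factor:
  assumes M: "M \<in> carrier_mat n n" and "mat_index M \<le> j"
  shows "\<exists>Y \<in> carrier_mat n n. M ^\<^sub>m mat_index M = M ^\<^sub>m j * Y"
  using assms(2)
proof (induction j rule: dec_induct)
  case base
  show ?case using M by (intro bexI[of _ "1\<^sub>m n"]) auto
next
  case (step j)
  let ?k = "mat_index M"
  obtain Y where Y: "Y \<in> carrier_mat n n" "M ^\<^sub>m ?k = M ^\<^sub>m j * Y" using step by blast
  obtain Z where Z: "Z \<in> carrier_mat n n" "M ^\<^sub>m ?k = M ^\<^sub>m Suc ?k * Z"
    using pow_mat_index_factor_Suc[OF M] .
  \<comment> \<open>One more power is gained by splitting off the factor \<open>M^k\<close> on the
    right of \<open>M^j\<close> and replacing it by \<open>M^(k+1) * Z\<close>.\<close>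
  have "M ^\<^sub>m j = M ^\<^sub>m (j - ?k) * M ^\<^sub>m ?k"
    using pow_mat_add[OF M, of "j - ?k" ?k] step.hyps by simp
  also have "\<dots> = M ^\<^sub>m (j - ?k) * (M ^\<^sub>m Suc ?k * Z)" using Z(2) by simp
  also have "\<dots> = M ^\<^sub>m (j - ?k) * M ^\<^sub>m Suc ?k * Z"
    using M Z(1) by (simp add: mult_mat_assoc)
  also have "M ^\<^sub>m (j - ?k) * M ^\<^sub>m Suc ?k = M ^\<^sub>m Suc j"
    using pow_mat_add[OF M, of "j - ?k" "Suc ?k"] step.hyps by simp
  finally have "M ^\<^sub>m ?k = M ^\<^sub>m Suc j * Z * Y" using Y(2) by simp
  then have "M ^\<^sub>m ?k = M ^\<^sub>m Suc j * (Z * Y)"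
    using Y(1) Z(1) M by (simp add: mult_mat_assoc)
  then show ?case using Y(1) Z(1) by (intro bexI[of _ "Z * Y"]) auto
qed

lemma column_space_pow_mat_index:
  assumes M: "M \<in> carrier_mat n n" and "mat_index M \<le> j"
  shows "column_space (M ^\<^sub>m j) = column_space (M ^\<^sub>m mat_index M)"
proof -
  obtain Y where Y: "Y \<in> carrier_mat n n" "M ^\<^sub>m mat_index M = M ^\<^sub>m j * Y"
    using pow_mat_index_factor[OF assms] by blast
  have "M ^\<^sub>m j = M ^\<^sub>m mat_index M * M ^\<^sub>m (j - mat_index M)"
    using pow_mat_add[OF M, of "mat_index M" "j - mat_index M"] assms(2) by simp
  with Y show ?thesis
    using M by (intro column_space_eqI[of _ n n _ n]) auto
qed

section \<open>Left and right factorizations of powers\<close>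

declare pow_mat.simps(2) [simp del]

text \<open>Column spaces produce factors on the right only; the transpose moves the factor to the
  left. The exponent is then the index of the transpose, which \<open>drazin_exists\<close> later
  reconciles with the index of \<open>M\<close>.\<close>

lemma pow_mat_index_factor_left:
  fixes M :: "complex mat"
  assumes M: "M \<in> carrier_mat n n"
  obtains j Z where "Z \<in> carrier_mat n n" "M ^\<^sub>m j = Z * M ^\<^sub>m Suc j"
proof -
  have T: "M\<^sup>T \<in> carrier_mat n n" using M by simp
  let ?j = "mat_index (M\<^sup>T)"
  obtain Y where Y: "Y \<in> carrier_mat n n" "(M\<^sup>T) ^\<^sub>m ?j = (M\<^sup>T) ^\<^sub>m Suc ?j * Y"
    using pow_mat_index_factor_Suc[OF T] .
  have "M ^\<^sub>m ?j = ((M\<^sup>T) ^\<^sub>m ?j)\<^sup>T" using pow_mat_transpose[OF M] by simp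
  also have "\<dots> = Y\<^sup>T * ((M\<^sup>T) ^\<^sub>m Suc ?j)\<^sup>T"
    using Y T by (metis transpose_mult pow_carrier_mat)
  also have "((M\<^sup>T) ^\<^sub>m Suc ?j)\<^sup>T = M ^\<^sub>m Suc ?j" using pow_mat_transpose[OF M] by (metis transpose_transpose)
  finally show ?thesis using that[of "Y\<^sup>T" ?j] Y(1) by simp
qed

text \<open>Each substitution of \<open>M^k = M^(k+1) * Y\<close> into itself adds one factor
  \<open>M\<close> on the left and one factor \<open>Y\<close> on the right.\<close>

lemma pow_mat_factor_right_iterate:
  assumes M: "M \<in> carrier_mat n n" and Y: "Y \<in> carrier_mat n n" "M ^\<^sub>m k = M ^\<^sub>m Suc k * Y"
  shows "M ^\<^sub>m k = M ^\<^sub>m (k + i) * Y ^\<^sub>m i"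
proof (induction i)
  case 0
  show ?case using M Y by simp
next
  case (Suc i)
  have "M ^\<^sub>m (k + i) = M ^\<^sub>m i * M ^\<^sub>m k" using pow_mat_add[OF M, of i k] by (simp add: add.commute)
  also have "\<dots> = M ^\<^sub>m i * M ^\<^sub>m Suc k * Y"
    using Y(1) M by (subst Y(2)) (simp add: mult_mat_assoc)
  also have "M ^\<^sub>m i * M ^\<^sub>m Suc k = M ^\<^sub>m (k + Suc i)"
    using pow_mat_add[OF M, of i "Suc k"] by (simp add: add.commute)
  finally have "M ^\<^sub>m k = M ^\<^sub>m (k + Suc i) * Y * Y ^\<^sub>m i" using Suc by simp
  also have "\<dots> = M ^\<^sub>m (k + Suc i) * Y ^\<^sub>m Suc i"
    using M Y(1) pow_mat_Suc_left[OF Y(1)] by (simp add: mult_mat_assoc)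
  finally show ?case .
qed

lemma pow_mat_factor_left_iterate:
  assumes M: "M \<in> carrier_mat n n" and Z: "Z \<in> carrier_mat n n" "M ^\<^sub>m k = Z * M ^\<^sub>m Suc k"
  shows "M ^\<^sub>m k = Z ^\<^sub>m i * M ^\<^sub>m (k + i)"
proof (induction i)
  case 0
  show ?case using M Z by simp
next
  case (Suc i)
  have "M ^\<^sub>m (k + i) = M ^\<^sub>m k * M ^\<^sub>m i" using pow_mat_add[OF M] by simp
  also have "\<dots> = Z * (M ^\<^sub>m Suc k * M ^\<^sub>m i)"
    using Z(1) M by (subst Z(2)) (simp add: mult_mat_assoc)
  also have "M ^\<^sub>m Suc k * M ^\<^sub>m i = M ^\<^sub>m (k + Suc i)"
    using pow_mat_add[OF M, of "Suc k" i] by simp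
  finally have "M ^\<^sub>m k = Z ^\<^sub>m i * (Z * M ^\<^sub>m (k + Suc i))" using Suc by simp
  also have "\<dots> = Z ^\<^sub>m Suc i * M ^\<^sub>m (k + Suc i)"
    using M Z(1) by (simp add: mult_mat_assoc pow_mat.simps(2))
  finally show ?case .
qed

section \<open>Drazin inverses\<close>

text \<open>Frees the power condition from the exact index: any exponent \<open>j\<close> will do.
  The matrix \<open>X * M\<close> fixes \<open>M^(k+j)\<close> from the left, and \<open>M^k\<close>
  with \<open>k\<close> the index is a right multiple of that power, so it is fixed as well.\<close>

lemma is_drazinI:
  assumes M: "M \<in> carrier_mat n n" and X: "X \<in> carrier_mat n n"
    and "X * M * X = X" and comm: "M * X = X * M" and j: "M ^\<^sub>m Suc j * X = M ^\<^sub>m j"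
  shows "is_drazin M X"
proof -
  let ?k = "mat_index M"
  obtain Z where Z: "Z \<in> carrier_mat n n" "M ^\<^sub>m ?k = M ^\<^sub>m (?k + j) * Z"
    using pow_mat_index_factor[OF M, of "?k + j"] by auto
  have XM: "X * M * M ^\<^sub>m (?k + j) = M ^\<^sub>m (?k + j)"
  proof -
    have "X * M * M ^\<^sub>m (?k + j) = X * (M * M ^\<^sub>m (?k + j))" using M X by (simp add: mult_mat_assoc)
    also have "\<dots> = X * M ^\<^sub>m (?k + Suc j)" using pow_mat_Suc_left[OF M] by simp
    also have "\<dots> = M ^\<^sub>m (?k + Suc j) * X" using pow_mat_commute[OF M X comm, of "?k + Suc j"] by simp
    also have "\<dots> = M ^\<^sub>m ?k * (M ^\<^sub>m Suc j * X)"
      using pow_mat_add[OF M, of ?k "Suc j"] M X by (simp add: mult_mat_assoc)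
    finally show ?thesis using j pow_mat_add[OF M] by simp
  qed
  have "M ^\<^sub>m Suc ?k * X = X * (M * M ^\<^sub>m ?k)"
    using pow_mat_commute[OF M X comm, of "Suc ?k"] pow_mat_Suc_left[OF M] by simp
  also have "\<dots> = X * M * M ^\<^sub>m (?k + j) * Z"
    using Z(1) M X by (subst Z(2)) (simp add: mult_mat_assoc)
  also have "\<dots> = M ^\<^sub>m ?k" using XM Z by simp
  finally show ?thesis using assms by (simp add: is_drazin_def)
qed

text \<open>A left and a right factorization at a common exponent make \<open>M\<close> strongly
  pi-regular, and the Drazin inverse is then an explicit product of powers.\<close>

lemma drazin_exists:
  assumes M: "M \<in> carrier_mat n n"
  shows "\<exists>X. is_drazin M X"
proof -
  obtain Y where Y: "Y \<in> carrier_mat n n" "M ^\<^sub>m mat_index M = M ^\<^sub>m Suc (mat_index M) * Y"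
    using pow_mat_index_factor_Suc[OF M] .
  obtain j Z where Z: "Z \<in> carrier_mat n n" "M ^\<^sub>m j = Z * M ^\<^sub>m Suc j"
    using pow_mat_index_factor_left[OF M] .
  \<comment> \<open>Multiplying by further powers of \<open>M\<close> keeps either factorization
    valid, so both hold at the sum of the two exponents.\<close>
  define k where "k = mat_index M + j"
  have c: "M ^\<^sub>m i \<in> carrier_mat n n" "Y ^\<^sub>m i \<in> carrier_mat n n" "Z ^\<^sub>m i \<in> carrier_mat n n" for i
    using M Y Z by auto
  have Yk: "M ^\<^sub>m k = M ^\<^sub>m Suc k * Y"
  proof -
    have "M ^\<^sub>m k = M ^\<^sub>m j * M ^\<^sub>m mat_index M" using pow_mat_add[OF M] by (simp add: k_def add.commute)
    also have "\<dots> = M ^\<^sub>m j * M ^\<^sub>m Suc (mat_index M) * Y"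
      using Y(1) M by (subst Y(2)) (simp add: mult_mat_assoc)
    also have "M ^\<^sub>m j * M ^\<^sub>m Suc (mat_index M) = M ^\<^sub>m Suc k"
      using pow_mat_add[OF M, of j "Suc (mat_index M)"] by (simp add: k_def add.commute)
    finally show ?thesis .
  qed
  have Zk: "M ^\<^sub>m k = Z * M ^\<^sub>m Suc k"
  proof -
    have "M ^\<^sub>m k = M ^\<^sub>m j * M ^\<^sub>m mat_index M" using pow_mat_add[OF M] by (simp add: k_def add.commute)
    also have "\<dots> = Z * (M ^\<^sub>m Suc j * M ^\<^sub>m mat_index M)"
      using Z(1) M by (subst Z(2)) (simp add: mult_mat_assoc)
    also have "M ^\<^sub>m Suc j * M ^\<^sub>m mat_index M = M ^\<^sub>m Suc k"
      using pow_mat_add[OF M, of "Suc j" "mat_index M"] by (simp add: k_def add.commute)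
    finally show ?thesis .
  qed
  note right = pow_mat_factor_right_iterate[OF M Y(1) Yk]
  note left = pow_mat_factor_left_iterate[OF M Z(1) Zk]
  \<comment> \<open>Both sides equal \<open>Z^i * M^(k+i) * Y^i\<close>.\<close>
  have ZY: "Z ^\<^sub>m i * M ^\<^sub>m k = M ^\<^sub>m k * Y ^\<^sub>m i" for i
  proof -
    have "Z ^\<^sub>m i * M ^\<^sub>m k = Z ^\<^sub>m i * M ^\<^sub>m (k + i) * Y ^\<^sub>m i"
      using right[of i] M Y(1) Z(1) by (simp add: mult_mat_assoc)
    then show ?thesis using left[of i] by simp
  qed
  \<comment> \<open>\<open>X\<close> has two forms, by \<open>ZY\<close>: the one with
    \<open>Y\<close> serves to compute \<open>M * X\<close>, the one with \<open>Z\<close> to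
    compute \<open>X * M\<close>. Both products collapse to \<open>M^k * Y^k\<close>, which gives
    commutation.\<close>
  define X where "X = M ^\<^sub>m k * Y ^\<^sub>m Suc k"
  have X: "X \<in> carrier_mat n n" using M Y(1) unfolding X_def by (intro mult_carrier_mat[of _ n n]) simp_all
  have X': "X = Z ^\<^sub>m Suc k * M ^\<^sub>m k" using ZY by (simp add: X_def)
  have MX: "M * X = M ^\<^sub>m k * Y ^\<^sub>m k"
  proof -
    have "M * X = M * M ^\<^sub>m k * Y * Y ^\<^sub>m k"
      using M Y(1) pow_mat_Suc_left[OF Y(1)] by (simp add: X_def mult_mat_assoc)
    also have "M * M ^\<^sub>m k * Y = M ^\<^sub>m k" using Yk pow_mat_Suc_left[OF M] by simp
    finally show ?thesis .
  qed
  have XM: "X * M = M ^\<^sub>m k * Y ^\<^sub>m k"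
  proof -
    have "X * M = Z ^\<^sub>m k * (Z * M ^\<^sub>m Suc k)"
      using M Z(1) by (simp add: X' mult_mat_assoc pow_mat.simps(2))
    then show ?thesis using Zk ZY by simp
  qed
  \<comment> \<open>The right-hand side is the iterated right factorization at \<open>i = k\<close>,
    hence equal to \<open>M^k\<close>.\<close>
  have "M ^\<^sub>m k * (M * X) = M ^\<^sub>m (k + k) * Y ^\<^sub>m k"
    unfolding MX pow_mat_add[OF M] using M Y(1) by (simp add: mult_mat_assoc)
  then have MMX: "M ^\<^sub>m k * (M * X) = M ^\<^sub>m k" unfolding right[of k, symmetric] .
  have "X * M * X = Z ^\<^sub>m Suc k * (M ^\<^sub>m k * (M * X))"
    using M X Z(1) by (subst X') (simp add: mult_mat_assoc)
  then have "X * M * X = X" using MMX X' by simp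
  moreover have "M ^\<^sub>m Suc k * X = M ^\<^sub>m k" using MMX M X by (simp add: mult_mat_assoc pow_mat.simps(2))
  ultimately show ?thesis using is_drazinI[OF M X] MX XM by auto
qed

text \<open>Commutation turns \<open>X = X * M * X\<close> into \<open>X = M * X * X\<close> and
  \<open>X = X * X * M\<close>; iterating brings arbitrarily many factors \<open>M\<close> to either
  side.\<close>

lemma outer_inverse_pow_factor:
  assumes M: "M \<in> carrier_mat n n" and X: "X \<in> carrier_mat n n"
    and XMX: "X * M * X = X" and comm: "M * X = X * M"
  shows "\<exists>Z \<in> carrier_mat n n. X = M ^\<^sub>m j * Z" "\<exists>Z \<in> carrier_mat n n. X = Z * M ^\<^sub>m j"
proof -
  show "\<exists>Z \<in> carrier_mat n n. X = M ^\<^sub>m j * Z"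
  proof (induction j)
    case 0
    show ?case using M X by (intro bexI[of _ X]) auto
  next
    case (Suc j)
    then obtain Z where Z: "Z \<in> carrier_mat n n" "X = M ^\<^sub>m j * Z" by blast
    have "M ^\<^sub>m Suc j * (Z * X) = M * (M ^\<^sub>m j * Z) * X"
      using M X Z(1) pow_mat_Suc_left[OF M] by (simp add: mult_mat_assoc)
    also have "\<dots> = X" using Z(2) XMX comm by simp
    finally show ?case using Z(1) X by (intro bexI[of _ "Z * X"]) auto
  qed
  show "\<exists>Z \<in> carrier_mat n n. X = Z * M ^\<^sub>m j"
  proof (induction j)
    case 0
    show ?case using M X by (intro bexI[of _ X]) auto
  next
    case (Suc j)
    then obtain Z where Z: "Z \<in> carrier_mat n n" "X = Z * M ^\<^sub>m j" by blast
    have "X * Z * M ^\<^sub>m Suc j = X * (Z * M ^\<^sub>m j * M)"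
      using M X Z(1) by (simp add: mult_mat_assoc pow_mat.simps(2))
    also have "\<dots> = X" using Z(2) XMX comm M X by (simp add: mult_mat_assoc)
    finally show ?case using Z(1) X by (intro bexI[of _ "X * Z"]) auto
  qed
qed

text \<open>Evaluate \<open>X * M * Y\<close> in two ways. Writing \<open>X = Z * M^k\<close> and
  using the power condition of \<open>Y\<close> gives \<open>X\<close>; writing
  \<open>Y = M^k * W\<close> and using that of \<open>X\<close> gives \<open>Y\<close>.\<close>

lemma drazin_unique:
  assumes M: "M \<in> carrier_mat n n" and "is_drazin M X" "is_drazin M Y"
  shows "X = Y"
proof -
  let ?k = "mat_index M"
  have X: "X \<in> carrier_mat n n" "X * M * X = X" "M * X = X * M" "M ^\<^sub>m Suc ?k * X = M ^\<^sub>m ?k"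
    and Y: "Y \<in> carrier_mat n n" "Y * M * Y = Y" "M * Y = Y * M" "M ^\<^sub>m Suc ?k * Y = M ^\<^sub>m ?k"
    using assms by (auto simp: is_drazin_def)
  obtain Z where Z: "Z \<in> carrier_mat n n" "X = Z * M ^\<^sub>m ?k"
    using outer_inverse_pow_factor(2)[OF M X(1-3)] by blast
  obtain W where W: "W \<in> carrier_mat n n" "Y = M ^\<^sub>m ?k * W"
    using outer_inverse_pow_factor(1)[OF M Y(1-3)] by blast
  have "X * M * Y = Z * (M ^\<^sub>m Suc ?k * Y)"
    using M Y(1) Z(1) by (subst Z(2)) (simp add: mult_mat_assoc pow_mat.simps(2))
  then have "X * M * Y = X" using Y(4) Z(2) by simp
  moreover have "X * M * Y = X * M ^\<^sub>m Suc ?k * W"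
    using M X(1) W(1) pow_mat_Suc_left[OF M] by (subst W(2)) (simp add: mult_mat_assoc)
  moreover have "X * M ^\<^sub>m Suc ?k = M ^\<^sub>m ?k" using pow_mat_commute[OF M X(1,3), of "Suc ?k"] X(4) by simp
  ultimately show ?thesis using W(2) by simp
qed

lemma drazin_eqI:
  assumes M: "M \<in> carrier_mat n n" and "is_drazin M X"
  shows "drazin M = X"
  unfolding drazin_def using assms drazin_unique[OF M] by (intro the_equality) auto

lemma is_drazin_drazin:
  assumes "M \<in> carrier_mat n n"
  shows "is_drazin M (drazin M)"
  using drazin_exists[OF assms] drazin_eqI[OF assms] by metis

section \<open>Moore-Penrose and core-EP inverses\<close>

lemma hermitian_cancel:
  fixes H C :: "complex mat"
  assumes H: "H \<in> carrier_mat n n" and herm: "mat_adjoint H = H" and C: "C \<in> carrier_mat n m"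
    and "H ^\<^sub>m Suc k * C = 0\<^sub>m n m"
  shows "H * C = 0\<^sub>m n m"
  using assms(4)
proof (induction k)
  case 0
  then show ?case using H by (simp add: pow_mat.simps(2))
next
  case (Suc k)
  have adj: "mat_adjoint (H ^\<^sub>m i) = H ^\<^sub>m i" for i
  proof (induction i)
    case 0
    then show ?case by simp
  next
    case (Suc i)
    have "mat_adjoint (H ^\<^sub>m Suc i) = H * H ^\<^sub>m i"
      using H Suc herm by (simp add: mat_adjoint_mult pow_mat.simps(2))
    then show ?case using pow_mat_Suc_left[OF H] by simp
  qed
  have "mat_adjoint (H ^\<^sub>m Suc k * C) * (H ^\<^sub>m Suc k * C) = mat_adjoint C * H ^\<^sub>m Suc k * (H ^\<^sub>m Suc k * C)"
    using H C adj by (simp add: mat_adjoint_mult)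
  also have "\<dots> = mat_adjoint C * H ^\<^sub>m k * (H * H ^\<^sub>m Suc k * C)"
    using H C by (simp add: mult_mat_assoc pow_mat.simps(2))
  also have "\<dots> = 0\<^sub>m m m"
    using Suc.prems pow_mat_Suc_left[OF H, of "Suc k"] H C by simp
  finally have zero: "mat_adjoint (H ^\<^sub>m Suc k * C) * (H ^\<^sub>m Suc k * C) = 0\<^sub>m m m" .
  have "H ^\<^sub>m Suc k * C = 0\<^sub>m n m"
    by (rule mat_adjoint_mult_self_eq_0[OF _ zero]) (use H C in auto)
  then show ?case by (rule Suc.IH)
qed

text \<open>With \<open>D\<close> the Drazin inverse of \<open>A\<^sup>* A\<close>, Hermitian cancellation yields
  \<open>A = A A\<^sup>* A D\<close>, so that \<open>D\<^sup>* A\<^sup>*\<close> is a least-squares inverse.\<close>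

lemma least_squares_inverse_exists:
  fixes A :: "complex mat"
  assumes A: "A \<in> carrier_mat n m"
  shows "\<exists>W \<in> carrier_mat m n. A * W * A = A \<and> mat_adjoint (A * W) = A * W"
proof -
  define H where "H = mat_adjoint A * A"
  have H: "H \<in> carrier_mat m m" and herm: "mat_adjoint H = H"
    using A by (auto simp: H_def mat_adjoint_mult)
  define D where "D = drazin H"
  have D: "D \<in> carrier_mat m m" "H * D = D * H" "H ^\<^sub>m Suc (mat_index H) * D = H ^\<^sub>m mat_index H"
    using is_drazin_drazin[OF H] H by (auto simp: D_def is_drazin_def)
  \<comment> \<open>\<open>C\<close> is the spectral projection onto the nilpotent part of
    \<open>H\<close>. A power of \<open>H\<close> kills it, so \<open>H\<close> does by Hermitian
    cancellation, and then the Gram matrix of \<open>A * C\<close> is zero.\<close>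
  define C where "C = 1\<^sub>m m - H * D"
  have C: "C \<in> carrier_mat m m" using H D by (auto simp: C_def)
  have "H ^\<^sub>m mat_index H * C = H ^\<^sub>m mat_index H - H ^\<^sub>m mat_index H * (H * D)"
    unfolding C_def using H D(1) by (subst mult_minus_distrib_mat[of _ m m _ m]) auto
  also have "H ^\<^sub>m mat_index H * (H * D) = H ^\<^sub>m mat_index H"
    using H D(1,3) by (simp add: mult_mat_assoc pow_mat.simps(2))
  also have "H ^\<^sub>m mat_index H - H ^\<^sub>m mat_index H = 0\<^sub>m m m" using H by auto
  finally have "H ^\<^sub>m Suc (mat_index H) * C = 0\<^sub>m m m"
    using H C pow_mat_Suc_left[OF H] by (simp add: mult_mat_assoc)
  then have HC: "H * C = 0\<^sub>m m m" by (rule hermitian_cancel[OF H herm C])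
  have "mat_adjoint (A * C) * (A * C) = mat_adjoint C * (H * C)"
    using A C by (simp add: mat_adjoint_mult mult_mat_assoc H_def)
  also have "\<dots> = 0\<^sub>m m m" using HC C by simp
  finally have zero: "mat_adjoint (A * C) * (A * C) = 0\<^sub>m m m" .
  have AC: "A * C = 0\<^sub>m n m"
    by (rule mat_adjoint_mult_self_eq_0[OF _ zero]) (use A C in auto)
  have AC': "A * C = A - A * (H * D)"
    unfolding C_def using A H D(1) by (subst mult_minus_distrib_mat[of _ n m _ m]) auto
  have AHD: "A * (H * D) = A"
  proof (rule eq_matI)
    fix i j assume ij: "i < dim_row A" "j < dim_col A"
    have "(A - A * (H * D)) $$ (i, j) = 0"
      using AC[unfolded AC'] ij A by simp
    moreover have "(A - A * (H * D)) $$ (i, j) = A $$ (i, j) - (A * (H * D)) $$ (i, j)"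
      using ij A D(1) by (intro index_minus_mat) auto
    ultimately show "(A * (H * D)) $$ (i, j) = A $$ (i, j)" by simp
  qed (use A H D(1) in auto)
  define W where "W = mat_adjoint D * mat_adjoint A"
  have W: "W \<in> carrier_mat m n" using A D by (auto simp: W_def)
  have "mat_adjoint (A * W) * A = A * (D * H)"
    using A D(1) by (simp add: W_def H_def mat_adjoint_mult mult_mat_assoc)
  then have A': "mat_adjoint (A * W) * A = A" using AHD D(2) by simp
  \<comment> \<open>This identifies \<open>A * W\<close> with its own Gram matrix, which is
    Hermitian.\<close>
  have "mat_adjoint (A * W) * (A * W) = mat_adjoint (A * W) * A * W"
    using A W by (simp add: mult_mat_assoc)
  then have *: "mat_adjoint (A * W) * (A * W) = A * W" unfolding A' .
  have "mat_adjoint (mat_adjoint (A * W) * (A * W)) = mat_adjoint (A * W) * (A * W)"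
    using mat_adjoint_mult[of "mat_adjoint (A * W)" "A * W"] by simp
  then have "mat_adjoint (A * W) = A * W" unfolding * .
  with A' W show ?thesis by (intro bexI[of _ W]) simp_all
qed

text \<open>\<open>M * X\<close> and \<open>M * Y\<close> are both the orthogonal projector onto the
  range of \<open>M\<close>, hence equal; likewise \<open>X * M = Y * M\<close>. Then
  \<open>X = X * M * X = Y * M * X = Y * M * Y = Y\<close>.\<close>

lemma moore_penrose_unique:
  assumes "is_moore_penrose M X" "is_moore_penrose M Y"
  shows "X = Y"
proof -
  have X: "X \<in> carrier_mat (dim_col M) (dim_row M)" "M * X * M = M" "X * M * X = X"
      "mat_adjoint (M * X) = M * X" "mat_adjoint (X * M) = X * M"
    and Y: "Y \<in> carrier_mat (dim_col M) (dim_row M)" "M * Y * M = M" "Y * M * Y = Y"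
      "mat_adjoint (M * Y) = M * Y" "mat_adjoint (Y * M) = Y * M"
    using assms by (auto simp: is_moore_penrose_def)
  have MX: "M * X = M * Y"
  proof -
    have "M * Y = mat_adjoint (M * Y)" using Y(4) by simp
    also have "\<dots> = mat_adjoint (M * X * M * Y)" using X(2) by simp
    also have "\<dots> = mat_adjoint (M * X * (M * Y))" using X(1) Y(1) by (simp add: mult_mat_assoc)
    also have "\<dots> = mat_adjoint (M * Y) * mat_adjoint (M * X)"
      using X(1) Y(1) by (subst mat_adjoint_mult) auto
    also have "\<dots> = M * Y * (M * X)" using X(4) Y(4) by simp
    also have "\<dots> = M * Y * M * X" using X(1) Y(1) by (simp add: mult_mat_assoc)
    also have "\<dots> = M * X" using Y(2) by simp
    finally show ?thesis by simp
  qed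
  have XM: "X * M = Y * M"
  proof -
    have "Y * M = mat_adjoint (Y * M)" using Y(5) by simp
    also have "\<dots> = mat_adjoint (Y * (M * X * M))" using X(2) by simp
    also have "\<dots> = mat_adjoint (Y * M * (X * M))" using X(1) Y(1) by (simp add: mult_mat_assoc)
    also have "\<dots> = mat_adjoint (X * M) * mat_adjoint (Y * M)"
      using X(1) Y(1) by (subst mat_adjoint_mult) auto
    also have "\<dots> = X * M * (Y * M)" using X(5) Y(5) by simp
    also have "\<dots> = X * (M * Y * M)" using X(1) Y(1) by (simp add: mult_mat_assoc)
    also have "\<dots> = X * M" using Y(2) by simp
    finally show ?thesis by simp
  qed
  have "X = Y * M * X" using X(3) XM by simp
  also have "\<dots> = Y * (M * X)" using X(1) Y(1) by (simp add: mult_mat_assoc)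
  also have "\<dots> = Y * M * Y" using MX X(1) Y(1) by (simp add: mult_mat_assoc)
  finally show ?thesis using Y(3) by simp
qed

lemma moore_penrose_eqI:
  assumes "is_moore_penrose M X"
  shows "moore_penrose M = X"
  unfolding moore_penrose_def using assms moore_penrose_unique by (intro the_equality) auto

section \<open>Existence and uniqueness of the core-EP inverse\<close>

lemma core_EP_inverse_exists:
  assumes M: "M \<in> carrier_mat n n"
  shows "\<exists>X. is_core_EP_inverse M X"
proof -
  define B where "B = M ^\<^sub>m mat_index M"
  have B: "B \<in> carrier_mat n n" using M by (simp add: B_def)
  define D where "D = drazin M"
  have D: "D \<in> carrier_mat n n" "M * D = D * M" and "M ^\<^sub>m Suc (mat_index M) * D = M ^\<^sub>m mat_index M"
    using is_drazin_drazin[OF M] M by (auto simp: D_def is_drazin_def)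
  then have MBD: "M * (B * D) = B"
    using M pow_mat_Suc_left[OF M] by (simp add: B_def mult_mat_assoc)
  have BD: "B * D = D * B" unfolding B_def by (rule pow_mat_commute[OF M D])
  have BM: "B * M = M * B" unfolding B_def using pow_mat_Suc_left[OF M] by (simp add: pow_mat.simps(2))
  obtain W where W: "W \<in> carrier_mat n n" "B * W * B = B" "mat_adjoint (B * W) = B * W"
    using least_squares_inverse_exists[OF B] by blast
  \<comment> \<open>\<open>P\<close> is the orthogonal projector onto the range of
    \<open>B = M^k\<close>, with \<open>k\<close> the index.\<close>
  define P where "P = B * W"
  have P: "P \<in> carrier_mat n n" "P * B = B" "mat_adjoint P = P"
    using B W by (auto simp: P_def)
  have PP: "P * P = P"
proof -
    have "P * P = P * B * W" using B W(1) P(1) by (subst (2) P_def) (simp add: mult_mat_assoc)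
    then show ?thesis using P(2) P_def by simp
  qed
  \<comment> \<open>The known formula for the core-EP inverse: the Drazin inverse times the
    orthogonal projector onto the range of \<open>M^k\<close>.\<close>
  define X where "X = D * P"
  have X: "X \<in> carrier_mat n n" using D P by (simp add: X_def)
  have MX: "M * X = P"
  proof -
    have "M * X = M * (B * D) * W"
      unfolding BD using M D(1) B W(1) by (simp add: X_def P_def mult_mat_assoc)
    then show ?thesis using MBD P_def by simp
  qed
  have XMX: "X * M * X = X"
  proof -
    have "X * M * X = X * (M * X)" using M X by (simp add: mult_mat_assoc)
    also have "\<dots> = D * (P * P)" unfolding MX using D(1) P(1) by (simp add: X_def mult_mat_assoc)
    finally show ?thesis using PP X_def by simp
  qed
  have XMB: "X * (M * B) = B"
  proof -
    have "X * (M * B) = D * (P * B * M)"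
      unfolding BM[symmetric] using M B D(1) P(1) by (simp add: X_def mult_mat_assoc)
    also have "\<dots> = B * D * M" unfolding P(2) BD using M B D(1) by (simp add: mult_mat_assoc)
    also have "\<dots> = B * M * D" using M B D by (simp add: mult_mat_assoc)
    also have "\<dots> = B" unfolding BM using MBD M B D(1) by (simp add: mult_mat_assoc)
    finally show ?thesis .
  qed
  have "X = D * B * W" using B D(1) W(1) by (simp add: X_def P_def mult_mat_assoc)
  then have "X = B * (D * W)"
    unfolding BD[symmetric] using B D(1) W(1) by (simp add: mult_mat_assoc)
  then have "column_space X = column_space B"
    using XMB X B M D(1) W(1)
    by (intro column_space_eqI[of X n n B n "D * W" "M * B"]) simp_all
  \<comment> \<open>Since \<open>P\<close> is Hermitian, the adjoint of \<open>X\<close> is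
    \<open>P * mat_adjoint D\<close> and starts with the factor \<open>B\<close>. Conversely, the
    adjoint of \<open>M * X = P\<close> fixes \<open>B\<close>.\<close>
  moreover have "column_space (mat_adjoint X) = column_space B"
  proof (rule column_space_eqI[of _ n n _ n])
    show "mat_adjoint X = B * (W * mat_adjoint D)"
    proof -
      have "mat_adjoint X = P * mat_adjoint D"
        using P(1,3) D(1) by (simp add: X_def mat_adjoint_mult)
      then show ?thesis using B W(1) D(1) by (simp add: P_def mult_mat_assoc)
    qed
    have "mat_adjoint X * (mat_adjoint M * B) = mat_adjoint (M * X) * B"
      using X M B by (simp add: mat_adjoint_mult mult_mat_assoc)
    then show "B = mat_adjoint X * (mat_adjoint M * B)" using MX P(2,3) by simp
  qed (use X M B D(1) W(1) in auto)
  ultimately show ?thesis using X XMX M by (auto simp: is_core_EP_inverse_def B_def)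
qed

text \<open>Equal ranges make \<open>Y\<close> a right multiple of \<open>X\<close>, and equal
  ranges of the adjoints make \<open>X\<close> a left multiple of \<open>Y\<close>. So
  \<open>X * M * Y\<close> equals \<open>Y\<close> by the first relation and \<open>X\<close> by the
  second.\<close>

lemma core_EP_inverse_unique:
  assumes M: "M \<in> carrier_mat n n" and "is_core_EP_inverse M X" "is_core_EP_inverse M Y"
  shows "X = Y"
proof -
  have X: "X \<in> carrier_mat n n" "X * M * X = X" and Y: "Y \<in> carrier_mat n n" "Y * M * Y = Y"
    and "column_space Y = column_space X" "column_space (mat_adjoint X) = column_space (mat_adjoint Y)"
    using assms by (auto simp: is_core_EP_inverse_def)
  then obtain Z W where Z: "Z \<in> carrier_mat n n" "Y = X * Z"
    and W: "W \<in> carrier_mat n n" "mat_adjoint X = mat_adjoint Y * W"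
    using column_space_subset_iff[of Y n n X n] column_space_subset_iff[of "mat_adjoint X" n n "mat_adjoint Y" n]
    by auto
  have XW: "X = mat_adjoint W * Y"
    using W Y(1) by (metis carrier_matD dim_mat_adjoint(2) mat_adjoint_mat_adjoint mat_adjoint_mult)
  have "X * M * Y = X * M * X * Z" using X(1) M Z by (simp add: mult_mat_assoc)
  then have "X * M * Y = Y" using X(2) Z(2) by simp
  moreover have "X * M * Y = mat_adjoint W * (Y * M * Y)"
    using X(1) Y(1) M W(1) by (subst XW) (simp add: mult_mat_assoc)
  ultimately show ?thesis using Y(2) XW by simp
qed

lemma core_EP_inverse_eqI:
  assumes M: "M \<in> carrier_mat n n" and "is_core_EP_inverse M X"
  shows "core_EP_inverse M = X"
  unfolding core_EP_inverse_def using assms core_EP_inverse_unique[OF M]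
  by (intro the_equality) auto

lemma is_core_EP_inverse_core_EP_inverse:
  assumes "M \<in> carrier_mat n n"
  shows "is_core_EP_inverse M (core_EP_inverse M)"
  using core_EP_inverse_exists[OF assms] core_EP_inverse_eqI[OF assms] by metis

section \<open>Inverses of a factorization\<close>

lemma pow_mat_mult_Suc:
  assumes V: "V \<in> carrier_mat n r" and B: "B \<in> carrier_mat r n"
  shows "(V * B) ^\<^sub>m Suc j = V * (B * V) ^\<^sub>m j * B"
proof (induction j)
  case 0
  then show ?case using V B by (simp add: pow_mat.simps(2))
next
  case (Suc j)
  have "(V * B) ^\<^sub>m Suc (Suc j) = V * (B * V) ^\<^sub>m j * B * (V * B)"
    using Suc by (simp add: pow_mat.simps(2)[of _ "Suc j"])
  also have "\<dots> = V * (B * V) ^\<^sub>m Suc j * B"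
    using V B by (simp add: pow_mat.simps(2) mult_mat_assoc)
  finally show ?case .
qed

text \<open>Cline's formula. With \<open>N = B * V\<close>, both products of the candidate with
  \<open>V * B\<close> reduce to \<open>V * D * B\<close>. The power condition is verified one
  exponent above the index of \<open>N\<close>, because
  \<open>(V * B)^(j+1) = V * N^j * B\<close>.\<close>

lemma drazin_mult:
  fixes V B :: "complex mat"
  assumes V: "V \<in> carrier_mat n r" and B: "B \<in> carrier_mat r n"
  shows "drazin (V * B) = V * (drazin (B * V) * drazin (B * V)) * B"
proof -
  define N where "N = B * V"
  define D where "D = drazin N"
  have N: "N \<in> carrier_mat r r" using V B by (auto simp: N_def)
  \<comment> \<open>Right-nested form of \<open>N = B * V\<close>, which recognises this product
    inside longer ones.\<close>
  have BV: "B * (V * Z) = N * Z" if "dim_row Z = r" for Z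
    using that V B by (simp add: N_def mult_mat_assoc)
  have D: "D \<in> carrier_mat r r" and DND: "D * N * D = D" and comm: "N * D = D * N"
    and k: "N ^\<^sub>m Suc (mat_index N) * D = N ^\<^sub>m mat_index N"
    using is_drazin_drazin[OF N] N by (auto simp: is_drazin_def D_def)
  have NDD: "N * (D * D) = D"
  proof -
    have "N * (D * D) = N * D * D" using N D by (simp add: mult_mat_assoc)
    then show ?thesis unfolding comm DND .
  qed
  have DDN: "D * (D * N) = D"
    unfolding comm[symmetric] using DND N D by (simp add: mult_mat_assoc)
  define A where "A = V * B"
  define X where "X = V * (D * D) * B"
  have A: "A \<in> carrier_mat n n" and X: "X \<in> carrier_mat n n" using V B D by (auto simp: A_def X_def)
  have AX: "A * X = V * D * B"
  proof -
    have "A * X = V * (B * (V * (D * D * B)))" using V B D by (simp add: A_def X_def mult_mat_assoc)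
    also have "\<dots> = V * (N * (D * D)) * B" using V B D N by (simp add: BV mult_mat_assoc)
    finally show ?thesis unfolding NDD .
  qed
  have XA: "X * A = V * D * B"
  proof -
    have "X * A = V * (D * (D * (B * (V * B))))" using V B D by (simp add: A_def X_def mult_mat_assoc)
    also have "\<dots> = V * (D * (D * N)) * B" using V B D N by (simp add: BV mult_mat_assoc)
    finally show ?thesis unfolding DDN .
  qed
  have "X * A * X = V * (D * (B * (V * (D * D * B))))"
    unfolding XA using V B D by (simp add: X_def mult_mat_assoc)
  also have "\<dots> = V * (D * N * D * D) * B" using V B D N by (simp add: BV mult_mat_assoc)
  finally have XAX: "X * A * X = X" unfolding DND X_def .
  have "A ^\<^sub>m Suc (Suc (mat_index N)) * X = A ^\<^sub>m Suc (mat_index N) * (A * X)"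
    using A X by (simp add: pow_mat.simps(2) mult_mat_assoc)
  also have "\<dots> = V * (N ^\<^sub>m mat_index N * (B * (V * (D * B))))"
    unfolding AX unfolding A_def pow_mat_mult_Suc[OF V B] N_def[symmetric] using V B D N
    by (simp add: mult_mat_assoc)
  also have "\<dots> = V * (N ^\<^sub>m Suc (mat_index N) * D) * B"
    using V B D N by (simp add: BV mult_mat_assoc pow_mat.simps(2))
  also have "\<dots> = A ^\<^sub>m Suc (mat_index N)"
    unfolding k A_def pow_mat_mult_Suc[OF V B] N_def[symmetric] ..
  finally have "is_drazin A X" using XAX AX XA by (intro is_drazinI[OF A X]) auto
  then show ?thesis using drazin_eqI[OF A] by (simp add: A_def X_def D_def N_def)
qed

lemma column_space_mult_cong:
  assumes C: "C \<in> carrier_mat n m" and X: "X \<in> carrier_mat m l" and Y: "Y \<in> carrier_mat m l'"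
    and eq: "column_space X = column_space Y"
  shows "column_space (C * X) = column_space (C * Y)"
proof -
  obtain Z W where "Z \<in> carrier_mat l' l" "X = Y * Z" and "W \<in> carrier_mat l l'" "Y = X * W"
    using column_space_subset_iff[OF X Y] column_space_subset_iff[OF Y X] eq by auto
  then have "C * X = C * Y * Z" "C * Y = C * X * W" "Z \<in> carrier_mat l' l" "W \<in> carrier_mat l l'"
    using C X Y by (metis assoc_mult_mat)+
  note ZW = this
  show ?thesis
    by (rule column_space_eqI[OF _ _ ZW(3,1,4,2)]) (use C X Y in auto)
qed

lemma column_space_mult_right_invertible:
  assumes C: "C \<in> carrier_mat n r" and B: "B \<in> carrier_mat r m" and B': "B' \<in> carrier_mat m r"
    and "B * B' = 1\<^sub>m r"
  shows "column_space (C * B) = column_space C"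
proof (rule column_space_eqI[OF _ C B _ B'])
  show "C * B \<in> carrier_mat n m" using C B by simp
  show "C = C * B * B'" using assms by (simp add: mult_mat_assoc)
qed simp

text \<open>\<open>V\<close> is an isometry, so passing from \<open>Z\<close> to
  \<open>V * Z * mat_adjoint V\<close> respects adjoints and carries the range of \<open>Z\<close>
  to its image under \<open>V\<close>. Right invertibility of \<open>B\<close> ensures that the
  stable range of \<open>V * B\<close> is the image of that of \<open>B * V\<close>.\<close>

lemma core_EP_inverse_mult:
  fixes V B B' :: "complex mat"
  assumes V: "V \<in> carrier_mat n r" and B: "B \<in> carrier_mat r n" and B': "B' \<in> carrier_mat n r"
    and VV: "mat_adjoint V * V = 1\<^sub>m r" and BB': "B * B' = 1\<^sub>m r"
  shows "core_EP_inverse (V * B) = V * core_EP_inverse (B * V) * mat_adjoint V"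
proof -
  define N where "N = B * V"
  define X where "X = core_EP_inverse N"
  have N: "N \<in> carrier_mat r r" using V B by (auto simp: N_def)
  have X: "X \<in> carrier_mat r r" and XNX: "X * N * X = X"
    and cX: "column_space X = column_space (N ^\<^sub>m mat_index N)"
    and cX': "column_space (mat_adjoint X) = column_space (N ^\<^sub>m mat_index N)"
    using is_core_EP_inverse_core_EP_inverse[OF N] N by (auto simp: is_core_EP_inverse_def X_def)
  define A where "A = V * B"
  define Y where "Y = V * X * mat_adjoint V"
  have A: "A \<in> carrier_mat n n" and Y: "Y \<in> carrier_mat n n" using V B X by (auto simp: A_def Y_def)
  have V': "mat_adjoint V \<in> carrier_mat r n" using V by simp
  \<comment> \<open>Large enough that both \<open>A^(j+1)\<close> and \<open>N^j\<close> have
    reached their stable ranges.\<close>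
  define j where "j = mat_index A + mat_index N"
  have "column_space (A ^\<^sub>m mat_index A) = column_space (A ^\<^sub>m Suc j)"
    by (rule column_space_pow_mat_index[OF A, symmetric]) (simp add: j_def)
  also have "\<dots> = column_space (V * N ^\<^sub>m j * B)"
    by (simp add: A_def N_def pow_mat_mult_Suc[OF V B])
  also have "\<dots> = column_space (V * N ^\<^sub>m j)"
    using V N by (intro column_space_mult_right_invertible[OF _ B B' BB']) auto
  also have "\<dots> = column_space (V * N ^\<^sub>m mat_index N)"
    by (rule column_space_mult_cong[OF V pow_carrier_mat[OF N] pow_carrier_mat[OF N]
        column_space_pow_mat_index[OF N]]) (simp add: j_def)
  finally have cA: "column_space (A ^\<^sub>m mat_index A) = column_space (V * N ^\<^sub>m mat_index N)" .
  \<comment> \<open>Stated for general \<open>Z\<close> because it is applied to \<open>X\<close>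
    and to its adjoint.\<close>
  have cVX: "column_space (V * Z * mat_adjoint V) = column_space (V * N ^\<^sub>m mat_index N)"
    if Z: "Z \<in> carrier_mat r r" "column_space Z = column_space (N ^\<^sub>m mat_index N)" for Z
  proof -
    have "column_space (V * Z * mat_adjoint V) = column_space (V * Z)"
      using V Z by (intro column_space_mult_right_invertible[OF _ V' V VV]) auto
    also have "\<dots> = column_space (V * N ^\<^sub>m mat_index N)"
      by (rule column_space_mult_cong[OF V Z(1) pow_carrier_mat[OF N] Z(2)])
    finally show ?thesis .
  qed
  have V'V: "mat_adjoint V * (V * Z) = Z" if "dim_row Z = r" for Z :: "complex mat"
    using that V VV mult_mat_assoc[of "mat_adjoint V" V Z] by auto
  have BV: "B * (V * Z) = N * Z" if "dim_row Z = r" for Z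
    using that V B by (simp add: N_def mult_mat_assoc)
  have "Y * A * Y = V * (X * (mat_adjoint V * (V * (B * (V * (X * mat_adjoint V))))))"
    using V B X by (simp add: A_def Y_def mult_mat_assoc)
  also have "\<dots> = V * (X * N * X) * mat_adjoint V"
    using V B X N by (simp add: V'V BV mult_mat_assoc)
  finally have YAY: "Y * A * Y = Y" unfolding XNX Y_def .
  have "mat_adjoint Y = V * mat_adjoint X * mat_adjoint V"
    using V X by (simp add: Y_def mat_adjoint_mult mult_mat_assoc)
  then have "column_space (mat_adjoint Y) = column_space (A ^\<^sub>m mat_index A)"
    using cVX[OF _ cX'] X cA by simp
  moreover have "column_space Y = column_space (A ^\<^sub>m mat_index A)"
    using cVX[OF X cX] cA by (simp add: Y_def)
  ultimately have "is_core_EP_inverse A Y"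
    using A Y YAY by (simp add: is_core_EP_inverse_def)
  then show ?thesis using core_EP_inverse_eqI[OF A] by (simp add: A_def Y_def X_def N_def)
qed

text \<open>A full-rank factorization: the two projectors are \<open>V * mat_adjoint V\<close> and
  \<open>B' * B\<close>, and \<open>herm\<close> makes \<open>B'\<close> the Moore-Penrose inverse
  of \<open>B\<close>.\<close>

lemma moore_penrose_mult:
  fixes V B B' :: "complex mat"
  assumes V: "V \<in> carrier_mat n r" and B: "B \<in> carrier_mat r n" and B': "B' \<in> carrier_mat n r"
    and VV: "mat_adjoint V * V = 1\<^sub>m r" and BB': "B * B' = 1\<^sub>m r"
    and herm: "mat_adjoint (B' * B) = B' * B"
  shows "moore_penrose (V * B) = B' * mat_adjoint V"
proof (rule moore_penrose_eqI)
  have V'V: "mat_adjoint V * (V * Z) = Z" if "dim_row Z = r" for Z :: "complex mat"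
    using that V VV mult_mat_assoc[of "mat_adjoint V" V Z] by auto
  have BB'Z: "B * (B' * Z) = Z" if "dim_row Z = r" for Z :: "complex mat"
    using that B B' BB' mult_mat_assoc[of B B' Z] by auto
  have AX: "V * B * (B' * mat_adjoint V) = V * mat_adjoint V"
    using V B B' by (simp add: BB'Z mult_mat_assoc)
  have XA: "B' * mat_adjoint V * (V * B) = B' * B"
    using V B B' by (simp add: V'V mult_mat_assoc)
  have "V * B * (B' * mat_adjoint V) * (V * B) = V * B"
    unfolding AX using V B by (simp add: V'V mult_mat_assoc)
  moreover have "B' * mat_adjoint V * (V * B) * (B' * mat_adjoint V) = B' * mat_adjoint V"
    unfolding XA using V B B' by (simp add: BB'Z mult_mat_assoc)
  moreover have "mat_adjoint (V * B * (B' * mat_adjoint V)) = V * B * (B' * mat_adjoint V)"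
    unfolding AX using V by (simp add: mat_adjoint_mult)
  ultimately show "is_moore_penrose (V * B) (B' * mat_adjoint V)"
    unfolding is_moore_penrose_def XA herm using V B B' by auto
qed

text \<open>With \<open>D\<close> the common inverse of \<open>B * V\<close>, both sides reduce to
  \<open>B' * B * V * D * mat_adjoint V\<close>. On the CMP side the square of \<open>D\<close> from
  Cline's formula loses one factor through \<open>D * D * (B * V) = D\<close>.\<close>

lemma CCE_inverse_eq_CMP_inverse:
  fixes V B B' :: "complex mat"
  assumes V: "V \<in> carrier_mat n r" and B: "B \<in> carrier_mat r n" and B': "B' \<in> carrier_mat n r"
    and VV: "mat_adjoint V * V = 1\<^sub>m r" and BB': "B * B' = 1\<^sub>m r"
    and herm: "mat_adjoint (B' * B) = B' * B"
    and eq: "core_EP_inverse (B * V) = drazin (B * V)"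
  shows "CCE_inverse (V * B) = CMP_inverse (V * B)"
proof -
  define D where "D = drazin (B * V)"
  have BV: "B * V \<in> carrier_mat r r" using V B by simp
  then have D: "D \<in> carrier_mat r r" and DBVD: "D * (B * V) * D = D" and comm: "B * V * D = D * (B * V)"
    using is_drazin_drazin[OF BV] V B by (auto simp: D_def is_drazin_def)
  have V'V: "mat_adjoint V * (V * Z) = Z" if "dim_row Z = r" for Z :: "complex mat"
    using that V VV mult_mat_assoc[of "mat_adjoint V" V Z] by auto
  have BB'Z: "B * (B' * Z) = Z" if "dim_row Z = r" for Z :: "complex mat"
    using that B B' BB' mult_mat_assoc[of B B' Z] by auto
  have "D * (D * (B * V)) = D * (B * V * D)" by (simp only: comm)
  also have "\<dots> = D" using DBVD V B D by (simp add: mult_mat_assoc)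
  finally have DDBV': "D * (D * (B * V)) = D" .
  have DDBV: "D * (D * (B * (V * Z))) = D * Z" if "dim_row Z = r" for Z
  proof -
    have "D * (D * (B * (V * Z))) = D * (D * (B * V)) * Z" using that V B D by (simp add: mult_mat_assoc)
    then show ?thesis unfolding DDBV' .
  qed
  note mp = moore_penrose_mult[OF V B B' VV BB' herm]
  have "CCE_inverse (V * B) = B' * (B * (V * (D * mat_adjoint V)))"
    unfolding CCE_inverse_def mp core_EP_inverse_mult[OF V B B' VV BB'] eq D_def[symmetric]
    using V B B' D by (simp add: V'V BB'Z mult_mat_assoc)
  moreover have "CMP_inverse (V * B) = B' * (B * (V * (D * mat_adjoint V)))"
    unfolding CMP_inverse_def core_part_def mp drazin_mult[OF V B] D_def[symmetric]
    using V B B' D by (simp add: V'V BB'Z DDBV mult_mat_assoc)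
  ultimately show ?thesis by simp
qed

section \<open>Hartwig-Spindelboeck decompositions\<close>

text \<open>Inverting each scalar while keeping the block sizes makes the block products match. The
  dimensions are part of the induction because multiplying blocks requires them.\<close>

lemma diag_block_mat_scalar_inverse:
  fixes \<sigma> :: "real list" and k :: "nat list"
  assumes "length \<sigma> = length k" "\<forall>s \<in> set \<sigma>. s \<noteq> 0"
  defines "D \<equiv> diag_block_mat (map2 (\<lambda>s m. complex_of_real s \<cdot>\<^sub>m 1\<^sub>m m) \<sigma> k)"
    and "D' \<equiv> diag_block_mat (map2 (\<lambda>s m. complex_of_real (inverse s) \<cdot>\<^sub>m 1\<^sub>m m) \<sigma> k)"
  shows "D \<in> carrier_mat (sum_list k) (sum_list k) \<and> D' \<in> carrier_mat (sum_list k) (sum_list k) \<and>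
    D * D' = 1\<^sub>m (sum_list k) \<and> D' * D = 1\<^sub>m (sum_list k)"
  using assms(1,2) unfolding D_def D'_def
proof (induction \<sigma> k rule: list_induct2)
  case Nil
  \<comment> \<open>The empty block diagonal is the zero matrix of size 0, which is also the
    identity of that size.\<close>
  have "0\<^sub>m 0 0 = (1\<^sub>m 0 :: complex mat)" by (rule eq_matI) auto
  then show ?case by simp
next
  case (Cons s \<sigma> m k)
  let ?K = "sum_list k"
  define D where "D = diag_block_mat (map2 (\<lambda>s m. complex_of_real s \<cdot>\<^sub>m 1\<^sub>m m) \<sigma> k)"
  define D' where "D' = diag_block_mat (map2 (\<lambda>s m. complex_of_real (inverse s) \<cdot>\<^sub>m 1\<^sub>m m) \<sigma> k)"
  let ?B = "\<lambda>s C. four_block_mat (complex_of_real s \<cdot>\<^sub>m 1\<^sub>m m) (0\<^sub>m m ?K) (0\<^sub>m ?K m) C"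
  have IH: "D \<in> carrier_mat ?K ?K" "D' \<in> carrier_mat ?K ?K" "D * D' = 1\<^sub>m ?K" "D' * D = 1\<^sub>m ?K"
    using Cons by (auto simp: D_def D'_def)
  have s: "s \<noteq> 0" using Cons.prems by simp
  have scal: "(a \<cdot>\<^sub>m 1\<^sub>m m) * (b \<cdot>\<^sub>m 1\<^sub>m m) = 1\<^sub>m m" if "a * b = 1" for a b :: complex
  proof -
    have "(a \<cdot>\<^sub>m 1\<^sub>m m) * (b \<cdot>\<^sub>m 1\<^sub>m m) = a \<cdot>\<^sub>m (b \<cdot>\<^sub>m 1\<^sub>m m)"
      by (subst mult_smult_assoc_mat[of _ m m _ m]) auto
    also have "\<dots> = 1\<^sub>m m" using that by (intro eq_matI) (auto simp flip: mult.assoc)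
    finally show ?thesis .
  qed
  have mult: "?B t C * ?B u C' = 1\<^sub>m (m + ?K)"
    if "t * u = 1" "C \<in> carrier_mat ?K ?K" "C' \<in> carrier_mat ?K ?K" "C * C' = 1\<^sub>m ?K" for t u C C'
  proof -
    have tu: "complex_of_real t * complex_of_real u = 1"
      using that(1) by (metis of_real_1 of_real_mult)
    have "?B t C * ?B u C' = four_block_mat (1\<^sub>m m) (0\<^sub>m m ?K) (0\<^sub>m ?K m) (1\<^sub>m ?K)"
      using that(2-4) scal[OF tu]
      by (subst mult_four_block_mat[of _ m m _ ?K _ ?K _ _ m _ ?K]) auto
    then show ?thesis by simp
  qed
  have "diag_block_mat (map2 (\<lambda>s m. complex_of_real s \<cdot>\<^sub>m 1\<^sub>m m) (s # \<sigma>) (m # k)) = ?B s D"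
    "diag_block_mat (map2 (\<lambda>s m. complex_of_real (inverse s) \<cdot>\<^sub>m 1\<^sub>m m) (s # \<sigma>) (m # k)) = ?B (inverse s) D'"
    using IH(1,2) by (simp_all add: Let_def del: of_real_inverse flip: D_def D'_def)
  note blocks = this
  show ?case
    unfolding blocks using mult[of s "inverse s" D D'] mult[of "inverse s" s D' D] IH s by simp
qed

lemma singular_value_diag_inverse:
  assumes "is_singular_value_diag A S" "S \<in> carrier_mat r r"
  obtains S' where "S' \<in> carrier_mat r r" "S * S' = 1\<^sub>m r" "S' * S = 1\<^sub>m r"
proof -
  obtain \<sigma> k where \<sigma>: "length \<sigma> = length k" "\<forall>s \<in> set \<sigma>. s > 0"
    and S: "S = diag_block_mat (map2 (\<lambda>s m. complex_of_real s \<cdot>\<^sub>m 1\<^sub>m m) \<sigma> k)"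
    using assms(1) by (auto simp: is_singular_value_diag_def)
  have "\<forall>s \<in> set \<sigma>. s \<noteq> 0" using \<sigma>(2) by auto
  note inv = diag_block_mat_scalar_inverse[OF \<sigma>(1) this, folded S]
  have "sum_list k = r" using inv assms(2) by auto
  then show ?thesis using that inv by auto
qed

theorem theorem11:
  fixes n r :: nat and A U S Q P :: "complex mat"
  assumes "A \<in> carrier_mat n n"
    and "mat_rank A = r"
    and "r > 0"
    and "hartwig_spindelboeck n r A U S Q P"
    and "core_EP_inverse (S * Q) = drazin (S * Q)"
  shows "EP_mat (CMP_inverse A) \<longleftrightarrow>
    CCE_inverse A * moore_penrose (CMP_inverse A) = moore_penrose (CMP_inverse A) * CCE_inverse A"
proof -
  have U: "U \<in> carrier_mat n n" "mat_adjoint U * U = 1\<^sub>m n" "U * mat_adjoint U = 1\<^sub>m n"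
    and S: "S \<in> carrier_mat r r" "is_singular_value_diag A S"
    and Q: "Q \<in> carrier_mat r r" and P: "P \<in> carrier_mat r (n - r)"
    and QP: "Q * mat_adjoint Q + P * mat_adjoint P = 1\<^sub>m r"
    and A: "A = U * four_block_mat (S * Q) (S * P) (0\<^sub>m (n - r) r) (0\<^sub>m (n - r) (n - r)) * mat_adjoint U"
    using assms(4) by (auto simp: hartwig_spindelboeck_def unitary_mat_def)
  \<comment> \<open>The rank is at most \<open>n\<close>, so the truncated difference
    \<open>n - r\<close> is genuine and the blocks fill \<open>n\<close> rows and columns.\<close>
  have rn: "r + (n - r) = n" using mat_rank_le_dim_row[OF assms(1)] assms(2) by simp
  obtain S' where S': "S' \<in> carrier_mat r r" "S * S' = 1\<^sub>m r" "S' * S = 1\<^sub>m r"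
    using singular_value_diag_inverse[OF S(2,1)] .
  \<comment> \<open>\<open>E\<close> is the identity stacked on zero and \<open>F\<close> is
    \<open>Q\<close> next to \<open>P\<close>. Blocks with no rows or no columns complete them to 2
    by 2 block matrices, so that all products follow from block multiplication.\<close>
  define E where "E = four_block_mat (1\<^sub>m r) (0\<^sub>m r 0) (0\<^sub>m (n - r) r) (0\<^sub>m (n - r) 0 :: complex mat)"
  define F where "F = four_block_mat Q P (0\<^sub>m 0 r) (0\<^sub>m 0 (n - r))"
  have E: "E \<in> carrier_mat n r" using rn by (auto simp: E_def)
  have F: "F \<in> carrier_mat r n" using rn Q P by (auto simp: F_def)
  have E': "mat_adjoint E = four_block_mat (1\<^sub>m r) (0\<^sub>m r (n - r)) (0\<^sub>m 0 r) (0\<^sub>m 0 (n - r))"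
    by (rule eq_matI) (auto simp: E_def)
  have "mat_adjoint E * E = four_block_mat (1\<^sub>m r) (0\<^sub>m r 0) (0\<^sub>m 0 r) (0\<^sub>m 0 0)"
    unfolding E' unfolding E_def
    by (subst mult_four_block_mat[of _ r r _ "n - r" _ 0 _ _ r _ 0]) auto
  also have "\<dots> = 1\<^sub>m r" by (rule eq_matI) auto
  finally have E'E: "mat_adjoint E * E = 1\<^sub>m r" .
  have "F * E = four_block_mat Q (0\<^sub>m r 0) (0\<^sub>m 0 r) (0\<^sub>m 0 0)"
    unfolding E_def F_def using Q P
    by (subst mult_four_block_mat[of _ r r _ "n - r" _ 0 _ _ r _ 0]) auto
  also have "\<dots> = Q" using Q by (intro eq_matI) auto
  finally have FE: "F * E = Q" .
  have F': "mat_adjoint F = four_block_mat (mat_adjoint Q) (0\<^sub>m r 0) (mat_adjoint P) (0\<^sub>m (n - r) 0)"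
    using Q P by (intro eq_matI) (auto simp: F_def)
  have "F * mat_adjoint F = four_block_mat (Q * mat_adjoint Q + P * mat_adjoint P) (0\<^sub>m r 0) (0\<^sub>m 0 r) (0\<^sub>m 0 0)"
    unfolding F' unfolding F_def using Q P
    by (subst mult_four_block_mat[of _ r r _ "n - r" _ 0 _ _ r _ 0]) auto
  also have "\<dots> = 1\<^sub>m r" unfolding QP by (rule eq_matI) auto
  finally have FF': "F * mat_adjoint F = 1\<^sub>m r" .
  \<comment> \<open>\<open>S\<close> is padded with empty blocks in the same way in order to
    multiply \<open>F\<close> blockwise.\<close>
  have S4: "four_block_mat S (0\<^sub>m r 0) (0\<^sub>m 0 r) (0\<^sub>m 0 0) = S"
    using S(1) by (intro eq_matI) auto
  have "four_block_mat S (0\<^sub>m r 0) (0\<^sub>m 0 r) (0\<^sub>m 0 0) * F = four_block_mat (S * Q) (S * P) (0\<^sub>m 0 r) (0\<^sub>m 0 (n - r))"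
    unfolding F_def using S(1) Q P
    by (subst mult_four_block_mat[of _ r r _ 0 _ 0 _ _ r _ "n - r"]) auto
  then have SF: "S * F = four_block_mat (S * Q) (S * P) (0\<^sub>m 0 r) (0\<^sub>m 0 (n - r))"
    unfolding S4 .
  have ESF: "E * (S * F) = four_block_mat (S * Q) (S * P) (0\<^sub>m (n - r) r) (0\<^sub>m (n - r) (n - r))"
    unfolding SF unfolding E_def using S(1) Q P
    by (subst mult_four_block_mat[of _ r r _ 0 _ "n - r" _ _ r _ "n - r"]) auto
  \<comment> \<open>\<open>V\<close> has orthonormal columns and \<open>G\<close> has orthonormal
    rows; the factor \<open>B\<close> of the general lemmas will be \<open>S * G\<close>.\<close>
  define V where "V = U * E"
  define G where "G = F * mat_adjoint U"
  have V: "V \<in> carrier_mat n r" and G: "G \<in> carrier_mat r n" using U E F by (auto simp: V_def G_def)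
  have U'U: "mat_adjoint U * (U * Z) = Z" if "dim_row Z = n" for Z
    using that U mult_mat_assoc[of "mat_adjoint U" U Z] by auto
  have VV: "mat_adjoint V * V = 1\<^sub>m r"
    using U E E'E by (simp add: V_def mat_adjoint_mult mult_mat_assoc U'U)
  have GG: "G * mat_adjoint G = 1\<^sub>m r"
    using U F FF' by (simp add: G_def mat_adjoint_mult mult_mat_assoc U'U)
  have GV: "G * V = Q"
    using U E F FE by (simp add: G_def V_def mult_mat_assoc U'U)
  have AVG: "A = V * (S * G)"
    unfolding A ESF[symmetric] using U E F S by (simp add: V_def G_def mult_mat_assoc)
  \<comment> \<open>The right inverse of \<open>S * G\<close> is \<open>mat_adjoint G * S'\<close>.
    In the opposite order \<open>S\<close> cancels as well, leaving the Hermitian matrix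
    \<open>mat_adjoint G * G\<close>.\<close>
  have "S * G * (mat_adjoint G * S') = S * (G * mat_adjoint G) * S'"
    using S S' G by (simp add: mult_mat_assoc)
  then have BB': "S * G * (mat_adjoint G * S') = 1\<^sub>m r" using GG S S' by simp
  have "mat_adjoint G * S' * (S * G) = mat_adjoint G * (S' * S) * G"
    using S(1) S'(1) G by (simp add: mult_mat_assoc)
  then have "mat_adjoint G * S' * (S * G) = mat_adjoint G * G" using S'(3) G by simp
  then have herm: "mat_adjoint (mat_adjoint G * S' * (S * G)) = mat_adjoint G * S' * (S * G)"
    using G by (simp only: mat_adjoint_mult dim_mat_adjoint mat_adjoint_mat_adjoint)
  have SG: "S * G \<in> carrier_mat r n" and GS: "mat_adjoint G * S' \<in> carrier_mat n r"
    using S(1) S'(1) G by auto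
  \<comment> \<open>This identifies the small matrix \<open>B * V\<close> of the general lemmas with
    the one in the hypothesis on core-EP and Drazin inverses.\<close>
  have N: "S * G * V = S * Q" using S(1) G V GV by (simp add: mult_mat_assoc)
  have "CCE_inverse A = CMP_inverse A"
    unfolding AVG
    by (rule CCE_inverse_eq_CMP_inverse[OF V SG GS VV BB' herm]) (simp only: N assms(5))
  \<comment> \<open>\<open>EP_mat\<close> also demands squareness; the commutation that it states is
    then the right-hand side with the CCE-inverse replaced by the CMP-inverse.\<close>
  moreover have "square_mat (CMP_inverse A)"
    unfolding AVG CMP_inverse_def core_part_def moore_penrose_mult[OF V SG GS VV BB' herm]
    using G V by simp
  ultimately show ?thesis by (simp add: EP_mat_def)
qed

end
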